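(* Let $\mathbf{FRel}$ be the symmetric monoidal category of finite sets and relations, where each finite set $A$ is equipped with the completely mixed state $\mu_A\colon I\to A$ (relating the point to every element of $A$) and the discarding effect $\varepsilon_A\colon A\to I$ (relating every element of $A$ to the point). Then $\mathbf{FRel}$ has purification and copurification. Hence the pairs $(\mathcal M,\mathcal P)$ (mixing and pure morphisms) and $(\mathcal C,\mathcal D)$ (copure and discarding morphisms) are symmetric monoidal weak factorisation systems.
   Context: $\mathbf{FRel}$: objects are finite sets, morphisms $A\to B$ are relations $r\subseteq A\times B$ with the usual composition of relations; the monoidal product is the Cartesian product of sets and of relations; the unit $I$ is a one-element set. Lifting: for morphisms $f\colon A\to B$ and $g\colon C\to D$ of a category, $f$ has the lifting property against $g$ when for all $u\colon A\to C$, $v\colon B\to D$ with $g\circ u=v\circ f$ there is $h\colon B\to C$ with $h\circ f=u$ and $g\circ h=v$. In a symmetric monoidal category, $f\oslash g$ means: for all objects $A',B'$, the morphism $f\otimes\mathrm{id}_{A'}$ has the lifting property against $g\otimes\mathrm{id}_{B'}$. For a collection $\mathcal A$ of morphisms, $\mathcal A^{\oslash}=\{g\mid \forall f\in\mathcal A\colon f\oslash g\}$ and ${}^{\oslash}\mathcal A=\{f\mid\forall g\in\mathcal A\colon f\oslash g\}$. Let $\mathcal M'$ be the collection of all completely mixed states $\mu_A$ and $\mathcal D'$ the collection of all discarding effects $\varepsilon_A$ ($A$ ranging over all finite sets). Pure morphisms: $\mathcal P=\mathcal M'^{\oslash}$; mixing morphisms: $\mathcal M={}^{\oslash}\mathcal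 P$; copure morphisms: $\mathcal C={}^{\oslash}\mathcal D'$; discarding morphisms: $\mathcal D=\mathcal C^{\oslash}$. The category has purification if every morphism $f\colon A\to B$ equals $p\circ(\mathrm{id}_A\otimes\mu_C)$ for some object $C$ and some pure $p\colon A\otimes C\to B$ (identifying $A$ with $A\otimes I$). It has copurification if every morphism $f\colon A\to B$ equals $(\varepsilon_C\otimes\mathrm{id}_B)\circ c$ for some object $C$ and some copure $c\colon A\to C\otimes B$ (identifying $I\otimes B$ with $B$). A symmetric monoidal weak factorisation system is a pair $(\mathcal L,\mathcal R)$ of collections of morphisms such that every morphism can be written as $r\circ l$ with $l\in\mathcal L$, $r\in\mathcal R$, and such that $\mathcal L={}^{\oslash}\mathcal R$ and $\mathcal R=\mathcal L^{\oslash}$.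
   Formalization: (Co)purification is proved with the completely mixed states and discarding effects taken only for nonempty finite sets, since it fails if the empty set is included; the empty set stays an object of FRel, and the factorisation systems are proved for both choices. *)

theory Defs
  imports Main
begin

section \<open>Symmetric monoidal categories\<close>

text \<open>Besides the symmetric monoidal structure, the record carries a state \<open>Mix A : I \<rightarrow> A\<close> and an
  effect \<open>Disc A : A \<rightarrow> I\<close> for every object \<open>A\<close>. No strictness is assumed.\<close>

record ('o, 'm) smc =
  Obj :: "'o set"
  Mor :: "'m set"
  Dom :: "'m \<Rightarrow> 'o"
  Cod :: "'m \<Rightarrow> 'o"
  Id :: "'o \<Rightarrow> 'm"
  Comp :: "'m \<Rightarrow> 'm \<Rightarrow> 'm"  (infixr "\<cdot>\<index>" 55)
  TensO :: "'o \<Rightarrow> 'o \<Rightarrow> 'o"  (infixr "\<odot>\<index>" 70)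
  TensM :: "'m \<Rightarrow> 'm \<Rightarrow> 'm"  (infixr "\<otimes>\<index>" 70)
  Unit :: "'o"
  LUnit :: "'o \<Rightarrow> 'm"
  RUnit :: "'o \<Rightarrow> 'm"
  Assoc :: "'o \<Rightarrow> 'o \<Rightarrow> 'o \<Rightarrow> 'm"
  Symm :: "'o \<Rightarrow> 'o \<Rightarrow> 'm"
  Mix :: "'o \<Rightarrow> 'm"
  Disc :: "'o \<Rightarrow> 'm"

definition Hom :: "('o, 'm) smc \<Rightarrow> 'o \<Rightarrow> 'o \<Rightarrow> 'm set" where
  "Hom K A B = {f \<in> Mor K. Dom K f = A \<and> Cod K f = B}"

definition is_iso :: "('o, 'm) smc \<Rightarrow> 'm \<Rightarrow> bool" where
  "is_iso K f \<longleftrightarrow> f \<in> Mor K \<and> (\<exists>g \<in> Hom K (Cod K f) (Dom K f).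
     g \<cdot>\<^bsub>K\<^esub> f = Id K (Dom K f) \<and> f \<cdot>\<^bsub>K\<^esub> g = Id K (Cod K f))"

locale symmetric_monoidal_category =
  fixes K :: "('o, 'm) smc" (structure)
  assumes dom_cod: "f \<in> Mor K \<Longrightarrow> Dom K f \<in> Obj K \<and> Cod K f \<in> Obj K"
    and id_hom: "A \<in> Obj K \<Longrightarrow> Id K A \<in> Hom K A A"
    and comp_hom: "f \<in> Hom K A B \<Longrightarrow> g \<in> Hom K B C \<Longrightarrow> g \<cdot> f \<in> Hom K A C"
    and id_left: "f \<in> Hom K A B \<Longrightarrow> Id K B \<cdot> f = f"
    and id_right: "f \<in> Hom K A B \<Longrightarrow> f \<cdot> Id K A = f"
    and comp_assoc: "f \<in> Hom K A B \<Longrightarrow> g \<in> Hom K B C \<Longrightarrow> h \<in> Hom K C D \<Longrightarrow>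
      (h \<cdot> g) \<cdot> f = h \<cdot> (g \<cdot> f)"
    and unit_obj: "Unit K \<in> Obj K"
    and tens_obj: "A \<in> Obj K \<Longrightarrow> B \<in> Obj K \<Longrightarrow> A \<odot> B \<in> Obj K"
    and tens_hom: "f \<in> Hom K A B \<Longrightarrow> g \<in> Hom K C D \<Longrightarrow> f \<otimes> g \<in> Hom K (A \<odot> C) (B \<odot> D)"
    and tens_id: "A \<in> Obj K \<Longrightarrow> B \<in> Obj K \<Longrightarrow> Id K A \<otimes> Id K B = Id K (A \<odot> B)"
    and tens_comp: "f \<in> Hom K A B \<Longrightarrow> g \<in> Hom K B C \<Longrightarrow> f' \<in> Hom K A' B' \<Longrightarrow> g' \<in> Hom K B' C' \<Longrightarrow>
      (g \<cdot> f) \<otimes> (g' \<cdot> f') = (g \<otimes> g') \<cdot> (f \<otimes> f')"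
    and lunit_hom: "A \<in> Obj K \<Longrightarrow> LUnit K A \<in> Hom K (Unit K \<odot> A) A"
    and runit_hom: "A \<in> Obj K \<Longrightarrow> RUnit K A \<in> Hom K (A \<odot> Unit K) A"
    and assoc_hom: "A \<in> Obj K \<Longrightarrow> B \<in> Obj K \<Longrightarrow> C \<in> Obj K \<Longrightarrow>
      Assoc K A B C \<in> Hom K ((A \<odot> B) \<odot> C) (A \<odot> (B \<odot> C))"
    and symm_hom: "A \<in> Obj K \<Longrightarrow> B \<in> Obj K \<Longrightarrow> Symm K A B \<in> Hom K (A \<odot> B) (B \<odot> A)"
    and lunit_iso: "A \<in> Obj K \<Longrightarrow> is_iso K (LUnit K A)"
    and runit_iso: "A \<in> Obj K \<Longrightarrow> is_iso K (RUnit K A)"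
    and assoc_iso: "A \<in> Obj K \<Longrightarrow> B \<in> Obj K \<Longrightarrow> C \<in> Obj K \<Longrightarrow> is_iso K (Assoc K A B C)"
    and lunit_nat: "f \<in> Hom K A B \<Longrightarrow> LUnit K B \<cdot> (Id K (Unit K) \<otimes> f) = f \<cdot> LUnit K A"
    and runit_nat: "f \<in> Hom K A B \<Longrightarrow> RUnit K B \<cdot> (f \<otimes> Id K (Unit K)) = f \<cdot> RUnit K A"
    and assoc_nat: "f \<in> Hom K A A' \<Longrightarrow> g \<in> Hom K B B' \<Longrightarrow> h \<in> Hom K C C' \<Longrightarrow>
      Assoc K A' B' C' \<cdot> ((f \<otimes> g) \<otimes> h) = (f \<otimes> (g \<otimes> h)) \<cdot> Assoc K A B C"
    and symm_nat: "f \<in> Hom K A A' \<Longrightarrow> g \<in> Hom K B B' \<Longrightarrow>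
      Symm K A' B' \<cdot> (f \<otimes> g) = (g \<otimes> f) \<cdot> Symm K A B"
    and triangle: "A \<in> Obj K \<Longrightarrow> B \<in> Obj K \<Longrightarrow>
      (Id K A \<otimes> LUnit K B) \<cdot> Assoc K A (Unit K) B = RUnit K A \<otimes> Id K B"
    and pentagon: "A \<in> Obj K \<Longrightarrow> B \<in> Obj K \<Longrightarrow> C \<in> Obj K \<Longrightarrow> D \<in> Obj K \<Longrightarrow>
      (Id K A \<otimes> Assoc K B C D) \<cdot> Assoc K A (B \<odot> C) D \<cdot> (Assoc K A B C \<otimes> Id K D)
      = Assoc K A B (C \<odot> D) \<cdot> Assoc K (A \<odot> B) C D"
    and hexagon: "A \<in> Obj K \<Longrightarrow> B \<in> Obj K \<Longrightarrow> C \<in> Obj K \<Longrightarrow>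
      (Id K B \<otimes> Symm K A C) \<cdot> Assoc K B A C \<cdot> (Symm K A B \<otimes> Id K C)
      = Assoc K B C A \<cdot> Symm K A (B \<odot> C) \<cdot> Assoc K A B C"
    and symm_inv: "A \<in> Obj K \<Longrightarrow> B \<in> Obj K \<Longrightarrow> Symm K B A \<cdot> Symm K A B = Id K (A \<odot> B)"
    and mix_hom: "A \<in> Obj K \<Longrightarrow> Mix K A \<in> Hom K (Unit K) A"
    and disc_hom: "A \<in> Obj K \<Longrightarrow> Disc K A \<in> Hom K A (Unit K)"


section \<open>Lifting and symmetric monoidal weak factorisation systems\<close>

definition lifts :: "('o, 'm) smc \<Rightarrow> 'm \<Rightarrow> 'm \<Rightarrow> bool" where
  "lifts K f g \<longleftrightarrow>
     (\<forall>u \<in> Hom K (Dom K f) (Dom K g). \<forall>v \<in> Hom K (Cod K f) (Cod K g).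
        g \<cdot>\<^bsub>K\<^esub> u = v \<cdot>\<^bsub>K\<^esub> f \<longrightarrow>
        (\<exists>h \<in> Hom K (Cod K f) (Dom K g). h \<cdot>\<^bsub>K\<^esub> f = u \<and> g \<cdot>\<^bsub>K\<^esub> h = v))"

definition oslash :: "('o, 'm) smc \<Rightarrow> 'm \<Rightarrow> 'm \<Rightarrow> bool" where
  "oslash K f g \<longleftrightarrow>
     (\<forall>A' \<in> Obj K. \<forall>B' \<in> Obj K. lifts K (f \<otimes>\<^bsub>K\<^esub> Id K A') (g \<otimes>\<^bsub>K\<^esub> Id K B'))"

definition right_class :: "('o, 'm) smc \<Rightarrow> 'm set \<Rightarrow> 'm set" where
  "right_class K \<A> = {g \<in> Mor K. \<forall>f \<in> \<A>. oslash K f g}"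

definition left_class :: "('o, 'm) smc \<Rightarrow> 'm set \<Rightarrow> 'm set" where
  "left_class K \<A> = {f \<in> Mor K. \<forall>g \<in> \<A>. oslash K f g}"

definition sm_weak_factorisation_system :: "('o, 'm) smc \<Rightarrow> 'm set \<Rightarrow> 'm set \<Rightarrow> bool" where
  "sm_weak_factorisation_system K L R \<longleftrightarrow>
     L \<subseteq> Mor K \<and> R \<subseteq> Mor K \<and>
     (\<forall>f \<in> Mor K. \<exists>l \<in> L. \<exists>r \<in> R. Dom K l = Dom K f \<and> Cod K l = Dom K r \<and> Cod K r = Cod K f \<and>
        f = r \<cdot>\<^bsub>K\<^esub> l) \<and>
     L = left_class K R \<and> R = right_class K L"


section \<open>Purity and purification\<close>

text \<open>The parameter \<open>E\<close> is the collection of objects \<open>A\<close> whose state \<open>Mix A\<close> and effect \<open>Disc A\<close>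
  are taken into account; \<open>E = Obj K\<close> means all of them.\<close>

definition pure :: "('o, 'm) smc \<Rightarrow> 'o set \<Rightarrow> 'm set" where
  "pure K E = right_class K (Mix K ` E)"

definition mixing :: "('o, 'm) smc \<Rightarrow> 'o set \<Rightarrow> 'm set" where
  "mixing K E = left_class K (pure K E)"

definition copure :: "('o, 'm) smc \<Rightarrow> 'o set \<Rightarrow> 'm set" where
  "copure K E = left_class K (Disc K ` E)"

definition discarding :: "('o, 'm) smc \<Rightarrow> 'o set \<Rightarrow> 'm set" where
  "discarding K E = right_class K (copure K E)"

text \<open>The identifications of \<open>A\<close> with \<open>A \<odot> I\<close> and of \<open>I \<odot> B\<close> with \<open>B\<close> are the unitors; composing
  \<open>f\<close> with the right unitor avoids mentioning its inverse.
  The environment object \<open>C\<close> is required to lie in \<open>E\<close>, so that \<open>Mix C\<close> and \<open>Disc C\<close> are among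
  the states and effects that define purity and copurity.\<close>

definition has_purification :: "('o, 'm) smc \<Rightarrow> 'o set \<Rightarrow> bool" where
  "has_purification K E \<longleftrightarrow>
     (\<forall>A \<in> Obj K. \<forall>B \<in> Obj K. \<forall>f \<in> Hom K A B.
        \<exists>C \<in> E. \<exists>p \<in> pure K E. p \<in> Hom K (A \<odot>\<^bsub>K\<^esub> C) B \<and>
          f \<cdot>\<^bsub>K\<^esub> RUnit K A = p \<cdot>\<^bsub>K\<^esub> (Id K A \<otimes>\<^bsub>K\<^esub> Mix K C))"

definition has_copurification :: "('o, 'm) smc \<Rightarrow> 'o set \<Rightarrow> bool" where
  "has_copurification K E \<longleftrightarrow>
     (\<forall>A \<in> Obj K. \<forall>B \<in> Obj K. \<forall>f \<in> Hom K A B.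
        \<exists>C \<in> E. \<exists>c \<in> copure K E. c \<in> Hom K A (C \<odot>\<^bsub>K\<^esub> B) \<and>
          f = LUnit K B \<cdot>\<^bsub>K\<^esub> (Disc K C \<otimes>\<^bsub>K\<^esub> Id K B) \<cdot>\<^bsub>K\<^esub> c)"


section \<open>Finite sets and relations\<close>

text \<open>HOL has no type of all sets, so objects are the finite subsets of a universe that contains a
  copy of an arbitrary type \<open>'a\<close>, a point, and is closed under pairing.\<close>

datatype 'a elem = Atom 'a | Pt | Tup "'a elem" "'a elem"

datatype 'a rel_mor =
  Rel (src: "'a elem set") (graph: "('a elem \<times> 'a elem) set") (tgt: "'a elem set")

type_synonym 'a frel = "('a elem set, 'a rel_mor) smc"

definition set_prod :: "'a elem set \<Rightarrow> 'a elem set \<Rightarrow> 'a elem set" where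
  "set_prod A B = {Tup a b | a b. a \<in> A \<and> b \<in> B}"

definition rel_prod :: "('a elem \<times> 'a elem) set \<Rightarrow> ('a elem \<times> 'a elem) set \<Rightarrow>
    ('a elem \<times> 'a elem) set" where
  "rel_prod r s = {(Tup a c, Tup b d) | a b c d. (a, b) \<in> r \<and> (c, d) \<in> s}"

definition FRel :: "'a frel" where
  "FRel = \<lparr>
     Obj = {A. finite A},
     Mor = {f. finite (src f) \<and> finite (tgt f) \<and> graph f \<subseteq> src f \<times> tgt f},
     Dom = src,
     Cod = tgt,
     Id = (\<lambda>A. Rel A (Id_on A) A),
     Comp = (\<lambda>g f. Rel (src f) (graph f O graph g) (tgt g)),
     TensO = set_prod,
     TensM = (\<lambda>f g. Rel (set_prod (src f) (src g)) (rel_prod (graph f) (graph g))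
                        (set_prod (tgt f) (tgt g))),
     Unit = {Pt},
     LUnit = (\<lambda>A. Rel (set_prod {Pt} A) {(Tup Pt a, a) | a. a \<in> A} A),
     RUnit = (\<lambda>A. Rel (set_prod A {Pt}) {(Tup a Pt, a) | a. a \<in> A} A),
     Assoc = (\<lambda>A B C. Rel (set_prod (set_prod A B) C)
        {(Tup (Tup a b) c, Tup a (Tup b c)) | a b c. a \<in> A \<and> b \<in> B \<and> c \<in> C}
        (set_prod A (set_prod B C))),
     Symm = (\<lambda>A B. Rel (set_prod A B) {(Tup a b, Tup b a) | a b. a \<in> A \<and> b \<in> B} (set_prod B A)),
     Mix = (\<lambda>A. Rel {Pt} ({Pt} \<times> A) A),
     Disc = (\<lambda>A. Rel A (A \<times> {Pt}) {Pt})\<rparr>"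

lemma finite_set_prod: "finite A \<Longrightarrow> finite B \<Longrightarrow> finite (set_prod A B)"
proof -
  assume "finite A" "finite B"
  moreover have "set_prod A B = (\<lambda>(a, b). Tup a b) ` (A \<times> B)"
    by (auto simp: set_prod_def)
  ultimately show ?thesis by simp
qed

lemma FRel_mor_eqI:
  "src f = src g \<Longrightarrow> tgt f = tgt g \<Longrightarrow> (\<And>x y. (x, y) \<in> graph f \<longleftrightarrow> (x, y) \<in> graph g) \<Longrightarrow> f = g"
  by (cases f; cases g) auto

lemma FRel_symmetric_monoidal_category: "symmetric_monoidal_category FRel"
proof -
  note D = FRel_def Hom_def
  note S = set_prod_def rel_prod_def
  have fin: "finite {Tup a b | a b. a \<in> A \<and> b \<in> B}" if "finite A" "finite B" for A B :: "'a elem set"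
    using finite_set_prod[OF that] by (simp add: set_prod_def)
  have lun: "is_iso FRel (LUnit FRel A)" if "A \<in> Obj FRel" for A :: "'a elem set"
    using that unfolding is_iso_def
    by (auto simp: D S fin intro!: exI[of _ "Rel A {(a, Tup Pt a) | a. a \<in> A} (set_prod {Pt} A)"])
  have run: "is_iso FRel (RUnit FRel A)" if "A \<in> Obj FRel" for A :: "'a elem set"
    using that unfolding is_iso_def
    by (auto simp: D S fin intro!: exI[of _ "Rel A {(a, Tup a Pt) | a. a \<in> A} (set_prod A {Pt})"])
  have ass: "is_iso FRel (Assoc FRel A B C)"
    if "A \<in> Obj FRel" "B \<in> Obj FRel" "C \<in> Obj FRel" for A B C :: "'a elem set"
    using that unfolding is_iso_def
    by (auto simp: D finite_set_prod
        intro!: exI[of _ "Rel (set_prod A (set_prod B C))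
        {(Tup a (Tup b c), Tup (Tup a b) c) | a b c. a \<in> A \<and> b \<in> B \<and> c \<in> C}
        (set_prod (set_prod A B) C)"]) (auto simp: S)
  show ?thesis
  proof (unfold_locales, goal_cases)
    case 4 then show ?case by (intro FRel_mor_eqI) (auto simp: D)
  next
    case 5 then show ?case by (intro FRel_mor_eqI) (auto simp: D)
  next
    case 8 then show ?case by (auto simp: D finite_set_prod)
  next
    case 9 then show ?case by (auto simp: D finite_set_prod) (auto simp: S)
  next
    case 10 then show ?case by (auto simp: D S)
  next
    case 11 then show ?case by (intro FRel_mor_eqI) (auto simp: D S relcomp_unfold, blast+)
  next
    case 12 then show ?case by (auto simp: D finite_set_prod) (auto simp: S)
  next
    case 13 then show ?case by (auto simp: D finite_set_prod) (auto simp: S)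
  next
    case 14 then show ?case by (auto simp: D finite_set_prod) (auto simp: S)
  next
    case 15 then show ?case by (auto simp: D finite_set_prod) (auto simp: S)
  next
    case 16 then show ?case by (rule lun)
  next
    case 17 then show ?case by (rule run)
  next
    case 18 then show ?case by (rule ass)
  next
    case 19 then show ?case by (intro FRel_mor_eqI) (fastforce simp: D S relcomp_unfold)+
  next
    case 20 then show ?case by (intro FRel_mor_eqI) (fastforce simp: D S relcomp_unfold)+
  next
    case 21 then show ?case by (intro FRel_mor_eqI) (fastforce simp: D S relcomp_unfold)+
  next
    case 22 then show ?case by (intro FRel_mor_eqI) (fastforce simp: D S relcomp_unfold)+
  next
    case 23 then show ?case by (intro FRel_mor_eqI) (auto simp: D S relcomp_unfold Id_on_iff)
  next
    case 24 then show ?case by (intro FRel_mor_eqI) (auto simp: D S relcomp_unfold Id_on_iff)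
  next
    case 25 then show ?case by (intro FRel_mor_eqI) (auto simp: D S relcomp_unfold Id_on_iff)
  next
    case 26 then show ?case by (auto simp: D S)
  qed (auto simp: D)
qed

text \<open>Taking all finite sets including the empty one for \<open>E\<close>, lifting against \<open>Mix {}\<close> forces pure
  relations to be total. Then \<open>FRel\<close> does not have purification: consider a relation that relates
  one element of its domain to something and another one to nothing. The dual argument refutes
  copurification.\<close>

lemma pure_FRel_total:
  assumes "p \<in> pure (FRel :: 'a frel) (Obj FRel)" and "x \<in> src p"
  shows "\<exists>y. (x, y) \<in> graph p"
proof (rule ccontr)
  assume n: "\<nexists>y. (x, y) \<in> graph p"
  have p: "p \<in> Mor FRel" and o: "oslash FRel (Mix FRel {}) p"
    using assms(1) by (auto simp: pure_def right_class_def FRel_def)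
  have l: "lifts FRel (Mix FRel {} \<otimes>\<^bsub>FRel\<^esub> Id FRel {Pt}) (p \<otimes>\<^bsub>FRel\<^esub> Id FRel {Pt})"
    using o unfolding oslash_def by (auto simp: FRel_def)
  let ?u = "Rel (set_prod {Pt} {Pt}) {(Tup Pt Pt, Tup x Pt)} (set_prod (src p) {Pt})"
  let ?v = "Rel {} {} (set_prod (tgt p) {Pt})"
  have "\<exists>h \<in> Hom FRel {} (set_prod (src p) {Pt}). h \<cdot>\<^bsub>FRel\<^esub> (Mix FRel {} \<otimes>\<^bsub>FRel\<^esub> Id FRel {Pt}) = ?u"
    using l[unfolded lifts_def, THEN bspec[of _ _ ?u], THEN bspec[of _ _ ?v]] p assms(2) n
    by (auto simp: FRel_def Hom_def finite_set_prod) (auto simp: set_prod_def rel_prod_def)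
  then show False by (auto simp: FRel_def Hom_def rel_prod_def)
qed

lemma copure_FRel_surjective:
  assumes "c \<in> copure (FRel :: 'a frel) (Obj FRel)" and "y \<in> tgt c"
  shows "\<exists>x. (x, y) \<in> graph c"
proof (rule ccontr)
  assume n: "\<nexists>x. (x, y) \<in> graph c"
  have c: "c \<in> Mor FRel" and o: "oslash FRel c (Disc FRel {})"
    using assms(1) by (auto simp: copure_def left_class_def FRel_def)
  have l: "lifts FRel (c \<otimes>\<^bsub>FRel\<^esub> Id FRel {Pt}) (Disc FRel {} \<otimes>\<^bsub>FRel\<^esub> Id FRel {Pt})"
    using o unfolding oslash_def by (auto simp: FRel_def)
  let ?u = "Rel (set_prod (src c) {Pt}) {} {}"
  let ?v = "Rel (set_prod (tgt c) {Pt}) {(Tup y Pt, Tup Pt Pt)} (set_prod {Pt} {Pt})"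
  have "\<exists>h \<in> Hom FRel (set_prod (tgt c) {Pt}) {}. (Disc FRel {} \<otimes>\<^bsub>FRel\<^esub> Id FRel {Pt}) \<cdot>\<^bsub>FRel\<^esub> h = ?v"
    using l[unfolded lifts_def, THEN bspec[of _ _ ?u], THEN bspec[of _ _ ?v]] c assms(2) n
    by (auto simp: FRel_def Hom_def finite_set_prod) (auto simp: set_prod_def rel_prod_def)
  then show False by (auto simp: FRel_def Hom_def rel_prod_def)
qed

lemma not_has_purification_FRel_all: "\<not> has_purification (FRel :: 'a frel) (Obj FRel)"
proof
  assume h: "has_purification (FRel :: 'a frel) (Obj FRel)"
  let ?A = "{Pt, Tup Pt Pt} :: 'a elem set"
  let ?f = "Rel ?A {(Pt, Pt)} {Pt}"
  obtain C p where p: "p \<in> pure FRel (Obj FRel)" "p \<in> Hom FRel (set_prod ?A C) {Pt}"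
    and e: "?f \<cdot>\<^bsub>FRel\<^esub> RUnit FRel ?A = p \<cdot>\<^bsub>FRel\<^esub> (Id FRel ?A \<otimes>\<^bsub>FRel\<^esub> Mix FRel C)"
    using h[unfolded has_purification_def, THEN bspec[of _ _ ?A], THEN bspec[of _ _ "{Pt}"],
        THEN bspec[of _ _ ?f]]
    by (auto simp: FRel_def Hom_def)
  let ?G = "graph (Id FRel ?A \<otimes>\<^bsub>FRel\<^esub> Mix FRel C) O graph p"
  have g: "?G = {(Tup Pt Pt, Pt)}"
    using arg_cong[OF e, of graph] by (auto simp: FRel_def)
  then obtain c where c: "c \<in> C" by (auto simp: FRel_def rel_prod_def)
  have "Tup (Tup Pt Pt) c \<in> src p" using p(2) c by (auto simp: FRel_def Hom_def set_prod_def)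
  then obtain y where "(Tup (Tup Pt Pt) c, y) \<in> graph p" using pure_FRel_total[OF p(1)] by blast
  moreover have "(Tup (Tup Pt Pt) Pt, Tup (Tup Pt Pt) c) \<in> graph (Id FRel ?A \<otimes>\<^bsub>FRel\<^esub> Mix FRel C)"
    using c by (auto simp: FRel_def rel_prod_def)
  ultimately have "(Tup (Tup Pt Pt) Pt, y) \<in> ?G" by blast
  then show False using g by auto
qed

lemma not_has_copurification_FRel_all: "\<not> has_copurification (FRel :: 'a frel) (Obj FRel)"
proof
  assume h: "has_copurification (FRel :: 'a frel) (Obj FRel)"
  let ?B = "{Pt, Tup Pt Pt} :: 'a elem set"
  let ?f = "Rel {Pt} {(Pt, Pt)} ?B"
  obtain C c where c: "c \<in> copure FRel (Obj FRel)" "c \<in> Hom FRel {Pt} (set_prod C ?B)"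
    and e: "?f = LUnit FRel ?B \<cdot>\<^bsub>FRel\<^esub> (Disc FRel C \<otimes>\<^bsub>FRel\<^esub> Id FRel ?B) \<cdot>\<^bsub>FRel\<^esub> c"
    using h[unfolded has_copurification_def, THEN bspec[of _ _ "{Pt}"], THEN bspec[of _ _ ?B],
        THEN bspec[of _ _ ?f]]
    by (auto simp: FRel_def Hom_def)
  let ?H = "graph (Disc FRel C \<otimes>\<^bsub>FRel\<^esub> Id FRel ?B) O graph (LUnit FRel ?B)"
  have g: "graph c O ?H = {(Pt, Pt)}"
    using arg_cong[OF e, of graph] by (simp add: FRel_def O_assoc)
  then have "graph c \<noteq> {}" by auto
  then obtain d where d: "d \<in> C" using c(2) by (fastforce simp: FRel_def Hom_def set_prod_def)
  have "Tup d (Tup Pt Pt) \<in> tgt c" using c(2) d by (auto simp: FRel_def Hom_def set_prod_def)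
  then obtain x where "(x, Tup d (Tup Pt Pt)) \<in> graph c"
    using copure_FRel_surjective[OF c(1)] by blast
  moreover have "(Tup d (Tup Pt Pt), Tup Pt Pt) \<in> ?H"
    using d by (auto simp: FRel_def rel_prod_def relcomp_unfold Id_on_iff)
  ultimately have "(x, Tup Pt Pt) \<in> graph c O ?H" by blast
  then show False using g by auto
qed

end

(* Lifting in FRel turns out to be governed by functionality: if the converse of f and g itself are
   single-valued, then the largest relation h compatible with u and v is a lift, as long as f or g
   is total and f or g is surjective. Conversely, lifting against the state of a two-element set
   forces pure morphisms to be single-valued, and dually for copure morphisms. Hence, without the
   empty set, the pure morphisms are the partial functions and the copure ones their converses; the
   empty set adds totality and surjectivity. A relation f from A to B is a partial function on
   A x B after the mixed state of B, and a projection after the converse of a partial function;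
   with the empty set included, one factors through the graph of f instead. *)

theory Submission
  imports Defs
begin

section \<open>Closure of the lifting classes\<close>

text \<open>\<open>left_class K\<close> and \<open>right_class K\<close> form an antitone Galois
  connection on sets of morphisms of \<open>K\<close>, so a third application undoes the first
  two.\<close>

lemma left_right_left_class:
  assumes "\<A> \<subseteq> Mor K"
  shows "left_class K (right_class K (left_class K \<A>)) = left_class K \<A>"
  using assms unfolding left_class_def right_class_def by blast

lemma right_left_right_class:
  assumes "\<A> \<subseteq> Mor K"
  shows "right_class K (left_class K (right_class K \<A>)) = right_class K \<A>"
  using assms unfolding left_class_def right_class_def by blast

section \<open>Lifting problems as equations between relations\<close>

lemma Mor_FRel_iff:
  "f \<in> Mor FRel \<longleftrightarrow> finite (src f) \<and> finite (tgt f) \<and> graph f \<subseteq> src f \<times> tgt f"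
  by (simp add: FRel_def)

text \<open>The objects in a lifting square are fixed by \<open>f\<close> and \<open>g\<close>,
  which leaves a problem about graphs; the bounds on \<open>U\<close>, \<open>V\<close> and
  \<open>H\<close> express well-typedness. Note that \<open>O\<close> composes in the order opposite
  to \<open>Comp\<close>.\<close>

lemma lifts_FRel_iff:
  fixes f g :: "'a rel_mor"
  assumes "f \<in> Mor FRel" "g \<in> Mor FRel"
  shows "lifts FRel f g \<longleftrightarrow>
    (\<forall>U V. U \<subseteq> src f \<times> src g \<longrightarrow> V \<subseteq> tgt f \<times> tgt g \<longrightarrow> U O graph g = graph f O V \<longrightarrow>
      (\<exists>H \<subseteq> tgt f \<times> src g. graph f O H = U \<and> H O graph g = V))" (is "_ \<longleftrightarrow> ?R")
proof
  assume l: "lifts FRel f g"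
  show ?R
  proof (intro allI impI)
    fix U V
    assume UV: "U \<subseteq> src f \<times> src g" "V \<subseteq> tgt f \<times> tgt g" "U O graph g = graph f O V"
    then obtain h where "h \<in> Hom FRel (tgt f) (src g)"
      "h \<cdot>\<^bsub>FRel\<^esub> f = Rel (src f) U (src g)" "g \<cdot>\<^bsub>FRel\<^esub> h = Rel (tgt f) V (tgt g)"
      using l[unfolded lifts_def, THEN bspec[of _ _ "Rel (src f) U (src g)"],
          THEN bspec[of _ _ "Rel (tgt f) V (tgt g)"]] assms
      by (auto simp: FRel_def Hom_def)
    then show "\<exists>H \<subseteq> tgt f \<times> src g. graph f O H = U \<and> H O graph g = V"
      by (intro exI[of _ "graph h"]) (auto simp: FRel_def Hom_def)
  qed
next
  assume R: ?R
  show "lifts FRel f g"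
    unfolding lifts_def
  proof (intro ballI impI)
    fix u v
    assume u: "u \<in> Hom FRel (Dom FRel f) (Dom FRel g)" and v: "v \<in> Hom FRel (Cod FRel f) (Cod FRel g)"
      and e: "g \<cdot>\<^bsub>FRel\<^esub> u = v \<cdot>\<^bsub>FRel\<^esub> f"
    have "graph u \<subseteq> src f \<times> src g" "graph v \<subseteq> tgt f \<times> tgt g"
      "graph u O graph g = graph f O graph v"
      using u v e by (auto simp: FRel_def Hom_def)
    then obtain H where "H \<subseteq> tgt f \<times> src g" "graph f O H = graph u" "H O graph g = graph v"
      using R by metis
    then show "\<exists>h \<in> Hom FRel (Cod FRel f) (Dom FRel g). h \<cdot>\<^bsub>FRel\<^esub> f = u \<and> g \<cdot>\<^bsub>FRel\<^esub> h = v"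
      using assms u v
      by (intro bexI[of _ "Rel (tgt f) H (src g)"] conjI FRel_mor_eqI) (auto simp: FRel_def Hom_def)
  qed
qed

lemma lifts_FRelD:
  fixes f g :: "'a rel_mor"
  assumes "lifts FRel f g" "f \<in> Mor FRel" "g \<in> Mor FRel"
    and "U \<subseteq> src f \<times> src g" "V \<subseteq> tgt f \<times> tgt g" "U O graph g = graph f O V"
  shows "\<exists>H. graph f O H = U \<and> H O graph g = V"
  using lifts_FRel_iff[OF assms(2,3), THEN iffD1, OF assms(1), rule_format, OF assms(4-6)] by auto

lemma lifts_FRel:
  fixes f g :: "'a rel_mor"
  assumes f: "f \<in> Mor FRel" and g: "g \<in> Mor FRel"
    and sv: "single_valued ((graph f)\<inverse>)" "single_valued (graph g)"
    and total: "Domain (graph f) = src f \<or> Domain (graph g) = src g"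
    and surj: "Range (graph f) = tgt f \<or> Range (graph g) = tgt g"
  shows "lifts FRel f g"
  unfolding lifts_FRel_iff[OF f g]
proof (intro allI impI)
  fix U V
  assume U: "U \<subseteq> src f \<times> src g" and V: "V \<subseteq> tgt f \<times> tgt g" and e: "U O graph g = graph f O V"
  have f1: "a = b" if "(a, x) \<in> graph f" "(b, x) \<in> graph f" for a b x
    using sv(1) that by (auto simp: single_valued_def)
  have g1: "d = d'" if "(c, d) \<in> graph g" "(c, d') \<in> graph g" for c d d'
    using sv(2) that by (auto simp: single_valued_def)
  have fm: "graph f \<subseteq> src f \<times> tgt f" and gm: "graph g \<subseteq> src g \<times> tgt g"
    using f g by (auto simp: Mor_FRel_iff)
  \<comment> \<open>The two universal conditions say exactly
    \<open>graph f O H \<subseteq> U\<close> and \<open>H O graph g \<subseteq> V\<close>, so only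
    the reverse inclusions take work.\<close>
  define H where "H = {(x, c). x \<in> tgt f \<and> c \<in> src g \<and> (\<forall>a. (a, x) \<in> graph f \<longrightarrow> (a, c) \<in> U) \<and>
    (\<forall>d. (c, d) \<in> graph g \<longrightarrow> (x, d) \<in> V)}"
  have "U \<subseteq> graph f O H"
  proof (intro subrelI)
    fix a c assume ac: "(a, c) \<in> U"
    show "(a, c) \<in> graph f O H"
    proof (cases "c \<in> Domain (graph g)")
      \<comment> \<open>Commutativity of the square provides \<open>x\<close>. Since
        \<open>a\<close> is the only preimage of \<open>x\<close> and \<open>d\<close> the only
        image of \<open>c\<close>, both conditions on \<open>(x, c)\<close> reduce to single known
        pairs.\<close>
      case True
      then obtain d x where "(c, d) \<in> graph g" "(a, x) \<in> graph f" "(x, d) \<in> V"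
        using e ac by (blast elim: equalityE)
      moreover from this have "\<forall>b. (b, x) \<in> graph f \<longrightarrow> (b, c) \<in> U"
        "\<forall>d. (c, d) \<in> graph g \<longrightarrow> (x, d) \<in> V"
        using ac by (metis f1, metis g1)
      ultimately have "(x, c) \<in> H" using ac U V by (auto simp: H_def)
      with \<open>(a, x) \<in> graph f\<close> show ?thesis by blast
    next
      \<comment> \<open>Here \<open>g\<close> is not total, so \<open>f\<close> is; any
        \<open>x\<close> related to \<open>a\<close> works, because the condition on images of
        \<open>c\<close> is vacuous.\<close>
      case False
      then have "a \<in> Domain (graph f)" using total ac U by auto
      then obtain x where "(a, x) \<in> graph f" by blast
      moreover from this have "\<forall>b. (b, x) \<in> graph f \<longrightarrow> (b, c) \<in> U"
        using ac by (metis f1)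
      ultimately have "(x, c) \<in> H" using False ac U fm by (auto simp: H_def)
      with \<open>(a, x) \<in> graph f\<close> show ?thesis by blast
    qed
  qed
  \<comment> \<open>Dual argument: an \<open>x\<close> outside the range of \<open>f\<close> makes
    the condition on preimages vacuous, and surjectivity of \<open>g\<close> yields
    \<open>c\<close>.\<close>
  moreover have "V \<subseteq> H O graph g"
  proof (intro subrelI)
    fix x d assume xd: "(x, d) \<in> V"
    show "(x, d) \<in> H O graph g"
    proof (cases "x \<in> Range (graph f)")
      case True
      then obtain a c where "(a, x) \<in> graph f" "(a, c) \<in> U" "(c, d) \<in> graph g"
        using e xd by (blast elim: equalityE)
      moreover from this have "\<forall>b. (b, x) \<in> graph f \<longrightarrow> (b, c) \<in> U"
        "\<forall>d. (c, d) \<in> graph g \<longrightarrow> (x, d) \<in> V"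
        using xd by (metis f1, metis g1)
      ultimately have "(x, c) \<in> H" using xd U V by (auto simp: H_def)
      with \<open>(c, d) \<in> graph g\<close> show ?thesis by blast
    next
      case False
      then have "d \<in> Range (graph g)" using surj xd V by auto
      then obtain c where "(c, d) \<in> graph g" by blast
      moreover from this have "\<forall>d. (c, d) \<in> graph g \<longrightarrow> (x, d) \<in> V"
        using xd by (metis g1)
      ultimately have "(x, c) \<in> H" using False xd V gm by (auto simp: H_def)
      with \<open>(c, d) \<in> graph g\<close> show ?thesis by blast
    qed
  qed
  moreover have "graph f O H \<subseteq> U" "H O graph g \<subseteq> V" "H \<subseteq> tgt f \<times> src g"
    by (auto simp: H_def)
  ultimately show "\<exists>H \<subseteq> tgt f \<times> src g. graph f O H = U \<and> H O graph g = V"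
    by blast
qed

section \<open>Stability under tensoring with identities\<close>

lemma tens_id_FRel [simp]:
  "src (f \<otimes>\<^bsub>FRel\<^esub> Id FRel A) = set_prod (src f) A"
  "tgt (f \<otimes>\<^bsub>FRel\<^esub> Id FRel A) = set_prod (tgt f) A"
  "graph (f \<otimes>\<^bsub>FRel\<^esub> Id FRel A) = rel_prod (graph f) (Id_on A)"
  by (simp_all add: FRel_def)

lemma tens_id_FRel_Mor:
  assumes "f \<in> Mor FRel" "finite A"
  shows "f \<otimes>\<^bsub>FRel\<^esub> Id FRel A \<in> Mor FRel"
  using assms by (auto simp: Mor_FRel_iff finite_set_prod) (auto simp: set_prod_def rel_prod_def)

lemma Domain_rel_prod: "Domain (rel_prod r s) = set_prod (Domain r) (Domain s)"
  by (auto simp: rel_prod_def set_prod_def) blast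

lemma Range_rel_prod: "Range (rel_prod r s) = set_prod (Range r) (Range s)"
  by (auto simp: rel_prod_def set_prod_def) blast

lemma single_valued_rel_prod:
  "single_valued r \<Longrightarrow> single_valued s \<Longrightarrow> single_valued (rel_prod r s)"
  by (auto simp: rel_prod_def single_valued_def)

lemma converse_rel_prod: "(rel_prod r s)\<inverse> = rel_prod (r\<inverse>) (s\<inverse>)"
  by (auto simp: rel_prod_def)

text \<open>All hypotheses of \<open>lifts_FRel\<close> survive tensoring with an identity, since
  \<open>rel_prod\<close> commutes with domain, range and converse and preserves
  single-valuedness.\<close>

lemma oslash_FRel:
  fixes f g :: "'a rel_mor"
  assumes "f \<in> Mor FRel" "g \<in> Mor FRel"
    and "single_valued ((graph f)\<inverse>)" "single_valued (graph g)"
    and "Domain (graph f) = src f \<or> Domain (graph g) = src g"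
    and "Range (graph f) = tgt f \<or> Range (graph g) = tgt g"
  shows "oslash FRel f g"
proof -
  have "lifts FRel (f \<otimes>\<^bsub>FRel\<^esub> Id FRel A) (g \<otimes>\<^bsub>FRel\<^esub> Id FRel B)" if "finite A" "finite B" for A B
    using assms that
    by (intro lifts_FRel tens_id_FRel_Mor)
      (auto simp: Domain_rel_prod Range_rel_prod converse_rel_prod single_valued_rel_prod)
  then show ?thesis by (auto simp: oslash_def FRel_def)
qed

section \<open>Pure and copure morphisms\<close>

lemma Mix_FRel [simp]:
  "src (Mix FRel A) = {Pt}" "tgt (Mix FRel A) = A" "graph (Mix FRel A) = {Pt} \<times> A"
  by (simp_all add: FRel_def)

lemma Disc_FRel [simp]:
  "src (Disc FRel A) = A" "tgt (Disc FRel A) = {Pt}" "graph (Disc FRel A) = A \<times> {Pt}"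
  by (simp_all add: FRel_def)

lemma Obj_FRel: "Obj FRel = {A. finite A}"
  by (simp add: FRel_def)

lemma Mix_FRel_Mor: "finite A \<Longrightarrow> Mix FRel A \<in> Mor FRel"
  by (auto simp: Mor_FRel_iff)

lemma Disc_FRel_Mor: "finite A \<Longrightarrow> Disc FRel A \<in> Mor FRel"
  by (auto simp: Mor_FRel_iff)

text \<open>A two-element ancilla can distribute the images of \<open>x\<close> over its two points,
  whereas a lift must send one of these points to \<open>x\<close> and hence to all images at
  once.\<close>

lemma single_valued_if_oslash_Mix:
  fixes p :: "'a rel_mor"
  assumes p: "p \<in> Mor FRel" and o: "oslash FRel (Mix FRel {Pt, Tup Pt Pt}) p"
  shows "single_valued (graph p)"
proof (intro single_valuedI allI impI, rule ccontr)
  fix x y z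
  assume xy: "(x, y) \<in> graph p" and xz: "(x, z) \<in> graph p" and ne: "y \<noteq> z"
  let ?m = "Mix (FRel :: 'a frel) {Pt, Tup Pt Pt} \<otimes>\<^bsub>FRel\<^esub> Id FRel {Pt}" and ?p = "p \<otimes>\<^bsub>FRel\<^esub> Id FRel {Pt}"
  \<comment> \<open>Both auxiliary objects are \<open>{Pt}\<close>, hence the trailing
    \<open>Pt\<close> in every element. \<open>?U\<close> selects \<open>x\<close>;
    \<open>?V\<close> sends the ancilla point \<open>Pt\<close> to \<open>y\<close> and the other
    point, \<open>Tup Pt Pt\<close>, to the remaining images of \<open>x\<close>. Both composites
    reach all images of \<open>x\<close>, so the square commutes.\<close>
  let ?U = "{(Tup Pt Pt, Tup x Pt)}"
  let ?V = "insert (Tup Pt Pt, Tup y Pt) {(Tup (Tup Pt Pt) Pt, Tup w Pt) | w. (x, w) \<in> graph p \<and> w \<noteq> y}"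
  have pm: "graph p \<subseteq> src p \<times> tgt p" using p by (simp add: Mor_FRel_iff)
  have l: "lifts FRel ?m ?p" using o by (simp add: oslash_def Obj_FRel)
  have "?U \<subseteq> src ?m \<times> src ?p" "?V \<subseteq> tgt ?m \<times> tgt ?p"
    using xy pm by (auto simp: set_prod_def)
  moreover have "?U O graph ?p = graph ?m O ?V"
    using xy by (auto simp: rel_prod_def relcomp_unfold Id_on_iff)
  ultimately obtain H where H: "graph ?m O H = ?U" "H O graph ?p = ?V"
    using lifts_FRelD[OF l, of ?U ?V] p by (auto simp only: tens_id_FRel_Mor Mix_FRel_Mor finite.intros)
  \<comment> \<open>Some ancilla point \<open>s\<close> is related to \<open>x\<close> by
    \<open>H\<close>, so \<open>?V\<close> would relate \<open>s\<close> to both \<open>y\<close>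
    and \<open>z\<close>, which it keeps apart.\<close>
  from H(1) have "(Tup Pt Pt, Tup x Pt) \<in> graph ?m O H" by simp
  then obtain s where "(Tup s Pt, Tup x Pt) \<in> H" "s \<in> {Pt, Tup Pt Pt}"
    by (auto simp: rel_prod_def)
  then have "(Tup s Pt, Tup y Pt) \<in> H O graph ?p" "(Tup s Pt, Tup z Pt) \<in> H O graph ?p"
    using xy xz by (auto simp: rel_prod_def intro!: relcompI[of _ "Tup x Pt"])
  then show False unfolding H(2) using ne by auto
qed

text \<open>Dual to the case of states: \<open>?V\<close> tests for \<open>x\<close>, while
  \<open>?U\<close> distributes the preimages of \<open>x\<close> over the two ancilla points. A
  lift sends \<open>x\<close> to one point \<open>s\<close>, and thereby all preimages of
  \<open>x\<close> to the same \<open>s\<close>.\<close>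

lemma single_valued_converse_if_oslash_Disc:
  fixes c :: "'a rel_mor"
  assumes c: "c \<in> Mor FRel" and o: "oslash FRel c (Disc FRel {Pt, Tup Pt Pt})"
  shows "single_valued ((graph c)\<inverse>)"
proof (intro single_valuedI allI impI, rule ccontr)
  fix x y z
  assume "(x, y) \<in> (graph c)\<inverse>" "(x, z) \<in> (graph c)\<inverse>" and ne: "y \<noteq> z"
  then have yx: "(y, x) \<in> graph c" and zx: "(z, x) \<in> graph c" by auto
  let ?d = "Disc (FRel :: 'a frel) {Pt, Tup Pt Pt} \<otimes>\<^bsub>FRel\<^esub> Id FRel {Pt}" and ?c = "c \<otimes>\<^bsub>FRel\<^esub> Id FRel {Pt}"
  let ?V = "{(Tup x Pt, Tup Pt Pt)}"
  let ?U = "insert (Tup y Pt, Tup Pt Pt) {(Tup w Pt, Tup (Tup Pt Pt) Pt) | w. (w, x) \<in> graph c \<and> w \<noteq> y}"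
  have cm: "graph c \<subseteq> src c \<times> tgt c" using c by (simp add: Mor_FRel_iff)
  have l: "lifts FRel ?c ?d" using o by (simp add: oslash_def Obj_FRel)
  have "?U \<subseteq> src ?c \<times> src ?d" "?V \<subseteq> tgt ?c \<times> tgt ?d"
    using yx cm by (auto simp: set_prod_def)
  moreover have "?U O graph ?d = graph ?c O ?V"
    using yx by (auto simp: rel_prod_def relcomp_unfold Id_on_iff) metis
  ultimately obtain H where H: "graph ?c O H = ?U" "H O graph ?d = ?V"
    using lifts_FRelD[OF l, of ?U ?V] c by (auto simp only: tens_id_FRel_Mor Disc_FRel_Mor finite.intros)
  from H(2) have "(Tup x Pt, Tup Pt Pt) \<in> H O graph ?d" by simp
  then obtain s where "(Tup x Pt, Tup s Pt) \<in> H" "s \<in> {Pt, Tup Pt Pt}"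
    by (auto simp: rel_prod_def)
  then have "(Tup y Pt, Tup s Pt) \<in> graph ?c O H" "(Tup z Pt, Tup s Pt) \<in> graph ?c O H"
    using yx zx by (auto simp: rel_prod_def intro!: relcompI[of _ "Tup x Pt"])
  then show False unfolding H(1) using ne by auto
qed

text \<open>The state of a nonempty set is total and surjective with single-valued converse, so
  \<open>oslash_FRel\<close> asks nothing of \<open>p\<close> beyond single-valuedness.\<close>

lemma pure_FRel_nonempty:
  "pure (FRel :: 'a frel) (Obj FRel - {{}}) = {p \<in> Mor FRel. single_valued (graph p)}"
proof (intro equalityI subsetI)
  fix p :: "'a rel_mor"
  assume "p \<in> pure FRel (Obj FRel - {{}})"
  then show "p \<in> {p \<in> Mor FRel. single_valued (graph p)}"
    by (auto simp: pure_def right_class_def Obj_FRel intro!: single_valued_if_oslash_Mix)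
next
  fix p :: "'a rel_mor"
  assume "p \<in> {p \<in> Mor FRel. single_valued (graph p)}"
  then show "p \<in> pure FRel (Obj FRel - {{}})"
    by (auto simp: pure_def right_class_def Obj_FRel single_valued_def intro!: oslash_FRel Mix_FRel_Mor)
qed

text \<open>\<open>Mix FRel {}\<close> is still surjective but no longer total, so totality has to
  come from \<open>p\<close>.\<close>

lemma pure_FRel_all:
  "pure (FRel :: 'a frel) (Obj FRel) =
    {p \<in> Mor FRel. single_valued (graph p) \<and> Domain (graph p) = src p}"
proof (intro equalityI subsetI)
  fix p :: "'a rel_mor"
  assume p: "p \<in> pure FRel (Obj FRel)"
  then have "p \<in> Mor FRel" "single_valued (graph p)"
    by (auto simp: pure_def right_class_def Obj_FRel intro!: single_valued_if_oslash_Mix)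
  moreover from this have "Domain (graph p) = src p"
    using pure_FRel_total[OF p] by (auto simp: Mor_FRel_iff)
  ultimately show "p \<in> {p \<in> Mor FRel. single_valued (graph p) \<and> Domain (graph p) = src p}"
    by simp
next
  fix p :: "'a rel_mor"
  assume "p \<in> {p \<in> Mor FRel. single_valued (graph p) \<and> Domain (graph p) = src p}"
  then show "p \<in> pure FRel (Obj FRel)"
    by (auto simp: pure_def right_class_def Obj_FRel single_valued_def intro!: oslash_FRel Mix_FRel_Mor)
qed

lemma copure_FRel_nonempty:
  "copure (FRel :: 'a frel) (Obj FRel - {{}}) = {c \<in> Mor FRel. single_valued ((graph c)\<inverse>)}"
proof (intro equalityI subsetI)
  fix c :: "'a rel_mor"
  assume "c \<in> copure FRel (Obj FRel - {{}})"
  then show "c \<in> {c \<in> Mor FRel. single_valued ((graph c)\<inverse>)}"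
    by (auto simp: copure_def left_class_def Obj_FRel intro!: single_valued_converse_if_oslash_Disc)
next
  fix c :: "'a rel_mor"
  assume "c \<in> {c \<in> Mor FRel. single_valued ((graph c)\<inverse>)}"
  then show "c \<in> copure FRel (Obj FRel - {{}})"
    by (auto simp: copure_def left_class_def Obj_FRel single_valued_def intro!: oslash_FRel Disc_FRel_Mor)
qed

text \<open>\<open>Disc FRel {}\<close> is total but not surjective, so surjectivity has to come
  from \<open>c\<close>.\<close>

lemma copure_FRel_all:
  "copure (FRel :: 'a frel) (Obj FRel) =
    {c \<in> Mor FRel. single_valued ((graph c)\<inverse>) \<and> Range (graph c) = tgt c}"
proof (intro equalityI subsetI)
  fix c :: "'a rel_mor"
  assume c: "c \<in> copure FRel (Obj FRel)"
  then have "c \<in> Mor FRel" "single_valued ((graph c)\<inverse>)"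
    by (auto simp: copure_def left_class_def Obj_FRel intro!: single_valued_converse_if_oslash_Disc)
  moreover from this have "Range (graph c) = tgt c"
    using copure_FRel_surjective[OF c] by (auto simp: Mor_FRel_iff)
  ultimately show "c \<in> {c \<in> Mor FRel. single_valued ((graph c)\<inverse>) \<and> Range (graph c) = tgt c}"
    by simp
next
  fix c :: "'a rel_mor"
  assume "c \<in> {c \<in> Mor FRel. single_valued ((graph c)\<inverse>) \<and> Range (graph c) = tgt c}"
  then show "c \<in> copure FRel (Obj FRel)"
    by (auto simp: copure_def left_class_def Obj_FRel single_valued_def intro!: oslash_FRel Disc_FRel_Mor)
qed

section \<open>Sufficient conditions for mixing and discarding morphisms\<close>

text \<open>A pure morphism may here be neither total nor surjective, so \<open>l\<close> supplies
  both properties.\<close>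

lemma mixing_FRel_nonemptyI:
  fixes l :: "'a rel_mor"
  assumes "l \<in> Mor FRel" "single_valued ((graph l)\<inverse>)"
    "Domain (graph l) = src l" "Range (graph l) = tgt l"
  shows "l \<in> mixing FRel (Obj FRel - {{}})"
  using assms unfolding mixing_def pure_FRel_nonempty
  by (auto simp: left_class_def intro!: oslash_FRel)

text \<open>Pure morphisms are now total, which leaves only surjectivity to
  \<open>l\<close>.\<close>

lemma mixing_FRel_allI:
  fixes l :: "'a rel_mor"
  assumes "l \<in> Mor FRel" "single_valued ((graph l)\<inverse>)" "Range (graph l) = tgt l"
  shows "l \<in> mixing FRel (Obj FRel)"
  using assms unfolding mixing_def pure_FRel_all
  by (auto simp: left_class_def intro!: oslash_FRel)

lemma discarding_FRel_nonemptyI: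
  fixes r :: "'a rel_mor"
  assumes "r \<in> Mor FRel" "single_valued (graph r)"
    "Domain (graph r) = src r" "Range (graph r) = tgt r"
  shows "r \<in> discarding FRel (Obj FRel - {{}})"
  using assms unfolding discarding_def copure_FRel_nonempty
  by (auto simp: right_class_def intro!: oslash_FRel)

lemma discarding_FRel_allI:
  fixes r :: "'a rel_mor"
  assumes "r \<in> Mor FRel" "single_valued (graph r)" "Domain (graph r) = src r"
  shows "r \<in> discarding FRel (Obj FRel)"
  using assms unfolding discarding_def copure_FRel_all
  by (auto simp: right_class_def intro!: oslash_FRel)

section \<open>Purification and copurification\<close>

text \<open>The ancilla is \<open>B\<close>, respectively \<open>A\<close>, enlarged by a point that keeps it nonempty.\<close>

lemma has_purification_FRel: "has_purification (FRel :: 'a frel) (Obj FRel - {{}})"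
  unfolding has_purification_def
proof (intro ballI)
  fix A B and f :: "'a rel_mor"
  assume f: "A \<in> Obj FRel" "B \<in> Obj FRel" "f \<in> Hom FRel A B"
  let ?C = "insert Pt B"
  \<comment> \<open>The input \<open>Tup a b\<close> determines the output \<open>b\<close>;
    \<open>?p\<close> is undefined where \<open>f\<close> does not relate \<open>a\<close> to
    \<open>b\<close>, in particular on pairs whose second entry is an added point outside
    \<open>B\<close>.\<close>
  let ?p = "Rel (set_prod A ?C) {(Tup a b, b) | a b. (a, b) \<in> graph f} B"
  have "?p \<in> pure FRel (Obj FRel - {{}})" "?p \<in> Hom FRel (A \<odot>\<^bsub>FRel\<^esub> ?C) B"
    using f unfolding pure_FRel_nonempty
    by (auto simp: FRel_def Hom_def finite_set_prod single_valued_def) (auto simp: set_prod_def)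
  moreover have "f \<cdot>\<^bsub>FRel\<^esub> RUnit FRel A = ?p \<cdot>\<^bsub>FRel\<^esub> (Id FRel A \<otimes>\<^bsub>FRel\<^esub> Mix FRel ?C)"
    using f by (intro FRel_mor_eqI)
      (auto simp: FRel_def Hom_def rel_prod_def relcomp_unfold Id_on_iff, blast)
  ultimately show "\<exists>C \<in> Obj FRel - {{}}. \<exists>p \<in> pure FRel (Obj FRel - {{}}).
      p \<in> Hom FRel (A \<odot>\<^bsub>FRel\<^esub> C) B \<and>
      f \<cdot>\<^bsub>FRel\<^esub> RUnit FRel A = p \<cdot>\<^bsub>FRel\<^esub> (Id FRel A \<otimes>\<^bsub>FRel\<^esub> Mix FRel C)"
    using f by (intro bexI[of _ ?C] bexI[of _ ?p]) (auto simp: Obj_FRel)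
qed

lemma has_copurification_FRel: "has_copurification (FRel :: 'a frel) (Obj FRel - {{}})"
  unfolding has_copurification_def
proof (intro ballI)
  fix A B and f :: "'a rel_mor"
  assume f: "A \<in> Obj FRel" "B \<in> Obj FRel" "f \<in> Hom FRel A B"
  let ?C = "insert Pt A"
  let ?c = "Rel A {(a, Tup a b) | a b. (a, b) \<in> graph f} (set_prod ?C B)"
  have "?c \<in> copure FRel (Obj FRel - {{}})" "?c \<in> Hom FRel A (?C \<odot>\<^bsub>FRel\<^esub> B)"
    using f unfolding copure_FRel_nonempty
    by (auto simp: FRel_def Hom_def finite_set_prod single_valued_def) (auto simp: set_prod_def)
  moreover have "f = LUnit FRel B \<cdot>\<^bsub>FRel\<^esub> (Disc FRel ?C \<otimes>\<^bsub>FRel\<^esub> Id FRel B) \<cdot>\<^bsub>FRel\<^esub> ?c"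
    using f by (intro FRel_mor_eqI) (auto simp: FRel_def Hom_def rel_prod_def relcomp_unfold Id_on_iff)
  ultimately show "\<exists>C \<in> Obj FRel - {{}}. \<exists>c \<in> copure FRel (Obj FRel - {{}}).
      c \<in> Hom FRel A (C \<odot>\<^bsub>FRel\<^esub> B) \<and>
      f = LUnit FRel B \<cdot>\<^bsub>FRel\<^esub> (Disc FRel C \<otimes>\<^bsub>FRel\<^esub> Id FRel B) \<cdot>\<^bsub>FRel\<^esub> c"
    using f by (intro bexI[of _ ?C] bexI[of _ ?c]) (auto simp: Obj_FRel)
qed

section \<open>Factorisations of every relation\<close>

definition factors :: "('o, 'm) smc \<Rightarrow> 'm set \<Rightarrow> 'm set \<Rightarrow> 'm \<Rightarrow> bool" where
  "factors K L R f \<longleftrightarrow> (\<exists>l \<in> L. \<exists>r \<in> R.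
     Dom K l = Dom K f \<and> Cod K l = Dom K r \<and> Cod K r = Cod K f \<and> f = r \<cdot>\<^bsub>K\<^esub> l)"

lemma factors_FRelI:
  assumes "Rel (src f) r X \<in> L" "Rel X s (tgt f) \<in> R" "graph f = r O s"
  shows "factors FRel L R f"
  unfolding factors_def
  by (intro bexI[OF _ assms(1)] bexI[OF _ assms(2)] conjI FRel_mor_eqI)
    (simp_all add: FRel_def assms(3))

text \<open>This is the purification read as a factorisation: the left factor is the mixed state of
  the ancilla tensored with the identity, precomposed with the inverse right unitor.\<close>

lemma factors_FRel_mixing_pure_nonempty:
  fixes f :: "'a rel_mor"
  assumes "f \<in> Mor FRel"
  shows "factors FRel (mixing FRel (Obj FRel - {{}})) (pure FRel (Obj FRel - {{}})) f"
proof (rule factors_FRelI)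
  \<comment> \<open>The added \<open>Pt\<close> makes the left factor total even when
    \<open>tgt f\<close> is empty.\<close>
  let ?X = "set_prod (src f) (insert Pt (tgt f))"
  show "Rel (src f) {(a, Tup a b) | a b. a \<in> src f \<and> b \<in> insert Pt (tgt f)} ?X
      \<in> mixing FRel (Obj FRel - {{}})"
    using assms by (intro mixing_FRel_nonemptyI)
      (auto simp: Mor_FRel_iff finite_set_prod single_valued_def, auto simp: set_prod_def)
  show "Rel ?X {(Tup a b, b) | a b. (a, b) \<in> graph f} (tgt f) \<in> pure FRel (Obj FRel - {{}})"
    using assms unfolding pure_FRel_nonempty
    by (auto simp: Mor_FRel_iff finite_set_prod single_valued_def) (auto simp: set_prod_def)
  show "graph f = {(a, Tup a b) | a b. a \<in> src f \<and> b \<in> insert Pt (tgt f)} O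
      {(Tup a b, b) | a b. (a, b) \<in> graph f}"
    using assms by (auto simp: Mor_FRel_iff relcomp_unfold)
qed

lemma factors_FRel_copure_discarding_nonempty:
  fixes f :: "'a rel_mor"
  assumes "f \<in> Mor FRel"
  shows "factors FRel (copure FRel (Obj FRel - {{}})) (discarding FRel (Obj FRel - {{}})) f"
proof (rule factors_FRelI)
  \<comment> \<open>Dually, the added \<open>Pt\<close> makes the right factor surjective even when
    \<open>src f\<close> is empty.\<close>
  let ?X = "set_prod (insert Pt (src f)) (tgt f)"
  show "Rel (src f) {(a, Tup a b) | a b. (a, b) \<in> graph f} ?X \<in> copure FRel (Obj FRel - {{}})"
    using assms unfolding copure_FRel_nonempty
    by (auto simp: Mor_FRel_iff finite_set_prod single_valued_def) (auto simp: set_prod_def)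
  show "Rel ?X {(Tup a b, b) | a b. a \<in> insert Pt (src f) \<and> b \<in> tgt f} (tgt f)
      \<in> discarding FRel (Obj FRel - {{}})"
    using assms by (intro discarding_FRel_nonemptyI)
      (auto simp: Mor_FRel_iff finite_set_prod single_valued_def, auto simp: set_prod_def)
  show "graph f = {(a, Tup a b) | a b. (a, b) \<in> graph f} O
      {(Tup a b, b) | a b. a \<in> insert Pt (src f) \<and> b \<in> tgt f}"
    using assms by (auto simp: Mor_FRel_iff relcomp_unfold)
qed

text \<open>The graph of \<open>f\<close>, encoded as a set of tuples, carries two projections,
  which are total functions; \<open>f\<close> is the converse of the first followed by the second.
  Leaving \<open>L\<close> and \<open>R\<close> open lets the argument serve both factorisation
  systems.\<close>

lemma factors_FRel_through_graph:
  fixes f :: "'a rel_mor"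
  assumes "f \<in> Mor FRel"
    and L: "\<And>l :: 'a rel_mor. l \<in> Mor FRel \<Longrightarrow> single_valued ((graph l)\<inverse>) \<Longrightarrow>
      Range (graph l) = tgt l \<Longrightarrow> l \<in> L"
    and R: "\<And>r :: 'a rel_mor. r \<in> Mor FRel \<Longrightarrow> single_valued (graph r) \<Longrightarrow>
      Domain (graph r) = src r \<Longrightarrow> r \<in> R"
  shows "factors FRel L R f"
proof (rule factors_FRelI)
  let ?X = "(\<lambda>(a, b). Tup a b) ` graph f"
  have fm: "finite (src f)" "finite (tgt f)" "graph f \<subseteq> src f \<times> tgt f"
    using assms(1) by (auto simp: Mor_FRel_iff)
  then have X: "finite ?X" by (meson finite_SigmaI finite_imageI finite_subset)
  show "Rel (src f) {(a, Tup a b) | a b. (a, b) \<in> graph f} ?X \<in> L"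
    using fm X by (intro L) (auto simp: Mor_FRel_iff single_valued_def)
  show "Rel ?X {(Tup a b, b) | a b. (a, b) \<in> graph f} (tgt f) \<in> R"
    using fm X by (intro R) (auto simp: Mor_FRel_iff single_valued_def)
  show "graph f = {(a, Tup a b) | a b. (a, b) \<in> graph f} O {(Tup a b, b) | a b. (a, b) \<in> graph f}"
    by (auto simp: relcomp_unfold)
qed

section \<open>The weak factorisation systems\<close>

text \<open>Given factorisations, what remains is that the classes determine each other: one
  equation is the definition of \<open>mixing\<close>, the other is
  \<open>right_left_right_class\<close>.\<close>

lemma sm_weak_factorisation_system_mixing_pure:
  assumes "Mix K ` E \<subseteq> Mor K" "\<And>f. f \<in> Mor K \<Longrightarrow> factors K (mixing K E) (pure K E) f"
  shows "sm_weak_factorisation_system K (mixing K E) (pure K E)"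
  using assms(2) right_left_right_class[OF assms(1)]
  by (auto simp: sm_weak_factorisation_system_def factors_def mixing_def pure_def)
    (auto simp: left_class_def right_class_def)

lemma sm_weak_factorisation_system_copure_discarding:
  assumes "Disc K ` E \<subseteq> Mor K" "\<And>f. f \<in> Mor K \<Longrightarrow> factors K (copure K E) (discarding K E) f"
  shows "sm_weak_factorisation_system K (copure K E) (discarding K E)"
  using assms(2) left_right_left_class[OF assms(1)]
  by (auto simp: sm_weak_factorisation_system_def factors_def copure_def discarding_def)
    (auto simp: left_class_def right_class_def)

theorem theorem16:
  shows "has_purification (FRel :: 'a frel) (Obj FRel - {{}}) \<and>
    has_copurification (FRel :: 'a frel) (Obj FRel - {{}}) \<and>
    (\<forall>E \<in> {Obj FRel - {{}}, Obj (FRel :: 'a frel)}.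
      sm_weak_factorisation_system FRel (mixing FRel E) (pure FRel E) \<and>
      sm_weak_factorisation_system FRel (copure FRel E) (discarding FRel E))"
proof (intro conjI ballI)
  show "has_purification (FRel :: 'a frel) (Obj FRel - {{}})"
    by (rule has_purification_FRel)
  show "has_copurification (FRel :: 'a frel) (Obj FRel - {{}})"
    by (rule has_copurification_FRel)
next
  fix E :: "'a elem set set"
  assume E: "E \<in> {Obj FRel - {{}}, Obj FRel}"
  then have Mor: "Mix FRel ` E \<subseteq> Mor FRel" "Disc FRel ` E \<subseteq> Mor FRel"
    by (auto simp: Obj_FRel intro: Mix_FRel_Mor Disc_FRel_Mor)
  \<comment> \<open>With the empty set in \<open>E\<close> no purification is at hand, so this case
    factors through the graph instead.\<close>
  have "factors FRel (mixing FRel (Obj FRel)) (pure FRel (Obj FRel)) f"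
    if "f \<in> Mor FRel" for f :: "'a rel_mor"
    using that by (rule factors_FRel_through_graph) (auto simp: pure_FRel_all intro: mixing_FRel_allI)
  then show "sm_weak_factorisation_system FRel (mixing FRel E) (pure FRel E)"
    using E factors_FRel_mixing_pure_nonempty Mor(1)
    by (intro sm_weak_factorisation_system_mixing_pure) auto
  have "factors FRel (copure FRel (Obj FRel)) (discarding FRel (Obj FRel)) f"
    if "f \<in> Mor FRel" for f :: "'a rel_mor"
    using that by (rule factors_FRel_through_graph) (auto simp: copure_FRel_all intro: discarding_FRel_allI)
  then show "sm_weak_factorisation_system FRel (copure FRel E) (discarding FRel E)"
    using E factors_FRel_copure_discarding_nonempty Mor(2)
    by (intro sm_weak_factorisation_system_copure_discarding) auto
qed

end
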